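(* Let $\delta\ge2$ and $\kappa\ge0$ be integers, let $\alpha_{j}\in(0,\pi)$ for $j=1,\ldots,\delta$, and consider the multivariate surface $$\mathbf{s}(\mathbf{u})=\left[s^{1}(\mathbf{u})\ \ s^{2}(\mathbf{u})\ \cdots\ s^{\delta+\kappa}(\mathbf{u})\right]\in\mathbb{R}^{\delta+\kappa},\quad\mathbf{u}=[u_{j}]_{j=1}^{\delta}\in\times_{j=1}^{\delta}[0,\alpha_{j}],$$ where, for $\ell=1,2,\ldots,\delta+\kappa$, $$s^{\ell}(\mathbf{u})=\sum_{\zeta=1}^{m_{\ell}}\prod_{j=1}^{\delta}\left(\sum_{p\in P_{\ell,\zeta,j}}c_{p}^{\ell,\zeta,j}\cos\left(pu_{j}+\psi_{p}^{\ell,\zeta,j}\right)+\sum_{q\in Q_{\ell,\zeta,j}}s_{q}^{\ell,\zeta,j}\sin\left(qu_{j}+\varphi_{q}^{\ell,\zeta,j}\right)\right)$$ with finite sets $P_{\ell,\zeta,j},Q_{\ell,\zeta,j}\subset\mathbb{N}$, $m_{\ell}\in\mathbb{N}\setminus\{0\}$ and $c_{p}^{\ell,\zeta,j},\psi_{p}^{\ell,\zeta,j},s_{q}^{\ell,\zeta,j},\varphi_{q}^{\ell,\zeta,j}\in\mathbb{R}$. For $j=1,\ldots,\delta$ let $n_{j}\ge1$ be an integer with $$n_{j}\ge n_{\min}^{j}=\max\left\{z_{j}:z_{j}\in\bigcup_{\ell=1}^{\delta+\kappa}\bigcup_{\zeta=1}^{m_{\ell}}\left(P_{\ell,\zeta,j}\cup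 Q_{\ell,\zeta,j}\right)\right\}.$$ Then for all $r_{1},r_{2},\ldots,r_{\delta}\in\mathbb{N}$ and all $\mathbf{u}\in\times_{j=1}^{\delta}[0,\alpha_{j}]$, $$\frac{\partial^{r_{1}+r_{2}+\cdots+r_{\delta}}}{\partial u_{1}^{r_{1}}\partial u_{2}^{r_{2}}\cdots\partial u_{\delta}^{r_{\delta}}}\mathbf{s}(\mathbf{u})=\sum_{i_{1}=0}^{2n_{1}}\sum_{i_{2}=0}^{2n_{2}}\cdots\sum_{i_{\delta}=0}^{2n_{\delta}}\mathbf{d}_{i_{1},i_{2},\ldots,i_{\delta}}(r_{1},r_{2},\ldots,r_{\delta})\prod_{j=1}^{\delta}T_{2n_{j},i_{j}}^{\alpha_{j}}(u_{j}),$$ where $\mathbf{d}_{i_{1},\ldots,i_{\delta}}(r_{1},\ldots,r_{\delta})=\left[d_{i_{1},\ldots,i_{\delta}}^{\ell}(r_{1},\ldots,r_{\delta})\right]_{\ell=1}^{\delta+\kappa}\in\mathbb{R}^{\delta+\kappa}$, $$d_{i_{1},\ldots,i_{\delta}}^{\ell}(r_{1},\ldots,r_{\delta})=\sum_{\zeta=1}^{m_{\ell}}\prod_{j=1}^{\delta}d_{i_{j}}^{\ell,\zeta,j}(r_{j}),\quad\ell=1,2,\ldots,\delta+\kappa,$$ and, for $\ell=1,\ldots,\delta+\kappa$, $\zeta=1,\ldots,m_{\ell}$, $j=1,\ldots,\delta$, $$d_{i_{j}}^{\ell,\zeta,j}(r_{j})=\sum_{p\in P_{\ell,\zeta,j}}c_{p}^{\ell,\zeta,j}p^{r_{j}}\left(\mu_{p,i_{j}}^{n_{j}}\cos\left(\psi_{p}^{\ell,\zeta,j}+\tfrac{r_{j}\pi}{2}\right)-\lambda_{p,i_{j}}^{n_{j}}\sin\left(\psi_{p}^{\ell,\zeta,j}+\tfrac{r_{j}\pi}{2}\right)\right)$$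 $$\qquad+\sum_{q\in Q_{\ell,\zeta,j}}s_{q}^{\ell,\zeta,j}q^{r_{j}}\left(\lambda_{q,i_{j}}^{n_{j}}\cos\left(\varphi_{q}^{\ell,\zeta,j}+\tfrac{r_{j}\pi}{2}\right)+\mu_{q,i_{j}}^{n_{j}}\sin\left(\varphi_{q}^{\ell,\zeta,j}+\tfrac{r_{j}\pi}{2}\right)\right),$$ the coefficients $\lambda_{k,i}^{n_{j}},\mu_{k,i}^{n_{j}}$ being those associated with the shape parameter $\alpha_{j}$.
   Context: Here $\mathbb{N}=\{0,1,2,\ldots\}$ and $0^{0}=1$. For an integer $n\ge1$ and $\alpha\in(0,\pi)$ let $$T_{2n,i}^{\alpha}(u)=t_{2n,i}^{\alpha}\,\sin^{2n-i}\!\left(\tfrac{\alpha-u}{2}\right)\sin^{i}\!\left(\tfrac{u}{2}\right),\quad u\in[0,\alpha],\ i=0,1,\ldots,2n,$$ where $$t_{2n,i}^{\alpha}=\frac{1}{\sin^{2n}(\alpha/2)}\sum_{r=0}^{\lfloor i/2\rfloor}\binom{n}{i-r}\binom{i-r}{r}\left(2\cos(\alpha/2)\right)^{i-2r}.$$ The functions $\{T_{2n,i}^{\alpha}\}_{i=0}^{2n}$ form a basis (the normalized B-basis) of $\operatorname{span}\{\cos(ku),\sin(ku):u\in[0,\alpha]\}_{k=0}^{n}$. For $k\in\{0,1,\ldots,n\}$, $\{\lambda_{k,i}^{n}\}_{i=0}^{2n}$ and $\{\mu_{k,i}^{n}\}_{i=0}^{2n}$ (which depend also on $\alpha$) denote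 the unique real numbers such that, for all $u\in[0,\alpha]$, $$\sin(ku)=\sum_{i=0}^{2n}\lambda_{k,i}^{n}T_{2n,i}^{\alpha}(u),\qquad \cos(ku)=\sum_{i=0}^{2n}\mu_{k,i}^{n}T_{2n,i}^{\alpha}(u).$$ *)

theory Defs
  imports "HOL-Analysis.Analysis"
begin

section \<open>The normalized B-basis of the trigonometric polynomials of order at most n\<close>

definition tB_coeff :: "real \<Rightarrow> nat \<Rightarrow> nat \<Rightarrow> real" where
  "tB_coeff \<alpha> n i =
     1 / sin (\<alpha> / 2) ^ (2 * n) *
     (\<Sum>r = 0..i div 2. real (n choose (i - r)) * real ((i - r) choose r)
                         * (2 * cos (\<alpha> / 2)) ^ (i - 2 * r))"

text \<open>The function \<open>T\<close> with lower index pair \<open>(2n, i)\<close> and shape parameter \<open>\<alpha>\<close>.\<close>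

definition tB :: "real \<Rightarrow> nat \<Rightarrow> nat \<Rightarrow> real \<Rightarrow> real" where
  "tB \<alpha> n i u = tB_coeff \<alpha> n i * sin ((\<alpha> - u) / 2) ^ (2 * n - i) * sin (u / 2) ^ i"

text \<open>
  The coordinates of a function on \<open>[0, \<alpha>]\<close> with respect to this basis. Coefficient
  sequences are continued by \<open>0\<close> beyond the index \<open>2n\<close>, so that uniqueness of the
  coefficients is uniqueness of the sequence.
\<close>

definition tB_coords :: "real \<Rightarrow> nat \<Rightarrow> (real \<Rightarrow> real) \<Rightarrow> nat \<Rightarrow> real" where
  "tB_coords \<alpha> n f =
     (THE a. (\<forall>i > 2 * n. a i = 0) \<and>
             (\<forall>u \<in> {0..\<alpha>}. f u = (\<Sum>i = 0..2 * n. a i * tB \<alpha> n i u)))"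

definition lambda_coeff :: "real \<Rightarrow> nat \<Rightarrow> nat \<Rightarrow> nat \<Rightarrow> real" where
  "lambda_coeff \<alpha> n k = tB_coords \<alpha> n (\<lambda>u. sin (real k * u))"

definition mu_coeff :: "real \<Rightarrow> nat \<Rightarrow> nat \<Rightarrow> nat \<Rightarrow> real" where
  "mu_coeff \<alpha> n k = tB_coords \<alpha> n (\<lambda>u. cos (real k * u))"

section \<open>Mixed partial derivatives on a set\<close>

definition upd_coord :: "real ^ 'd \<Rightarrow> 'd \<Rightarrow> real \<Rightarrow> real ^ 'd" where
  "upd_coord u j t = (\<chi> i. if i = j then t else u $ i)"

text \<open>
  On \<open>B\<close>, the function \<open>g\<close> is the first-order partial derivative of \<open>f\<close> with respect to the
  \<open>j\<close>-th coordinate. Only values of \<open>f\<close> on \<open>B\<close> matter: at boundary points of a box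
  the derivative is one-sided.
\<close>

definition has_partial_on ::
  "(real ^ 'd::finite) set \<Rightarrow> 'd \<Rightarrow> (real ^ 'd \<Rightarrow> 'b::real_normed_vector) \<Rightarrow> (real ^ 'd \<Rightarrow> 'b) \<Rightarrow> bool"
  where
  "has_partial_on B j f g \<longleftrightarrow>
     (\<forall>u \<in> B. ((\<lambda>t. f (upd_coord u j t)) has_vector_derivative g u)
                (at (u $ j) within {t. upd_coord u j t \<in> B}))"

text \<open>
  For \<open>js = [j\<^sub>1, \<dots>, j\<^sub>k]\<close>: all the successive partial derivatives exist on \<open>B\<close>, and
  \<open>\<partial>\<^sub>j\<^sub>1 (\<partial>\<^sub>j\<^sub>2 (\<dots> (\<partial>\<^sub>j\<^sub>k f)))\<close> equals \<open>g\<close> on \<open>B\<close>.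
\<close>

fun has_iterated_partial_on ::
  "(real ^ 'd::finite) set \<Rightarrow> 'd list \<Rightarrow> (real ^ 'd \<Rightarrow> 'b::real_normed_vector)
     \<Rightarrow> (real ^ 'd \<Rightarrow> 'b) \<Rightarrow> bool"
  where
  "has_iterated_partial_on B [] f g \<longleftrightarrow> (\<forall>u \<in> B. f u = g u)"
| "has_iterated_partial_on B (j # js) f g \<longleftrightarrow>
     (\<exists>h. has_iterated_partial_on B js f h \<and> has_partial_on B j h g)"

text \<open>
  The index type of the variables is a finite linear order, i.e. a copy of \<open>1 < \<dots> < \<delta>\<close>. As in
  the usual notation for the mixed partial derivative of order \<open>(r\<^sub>1, \<dots>, r\<^sub>\<delta>)\<close>, the derivatives with
  respect to the last variable are taken first.
\<close>

definition has_mixed_partial_on ::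
  "(real ^ 'd::{finite,linorder}) set \<Rightarrow> ('d \<Rightarrow> nat) \<Rightarrow> (real ^ 'd::{finite,linorder} \<Rightarrow> 'b::real_normed_vector)
     \<Rightarrow> (real ^ 'd::{finite,linorder} \<Rightarrow> 'b) \<Rightarrow> bool"
  where
  "has_mixed_partial_on B r f g \<longleftrightarrow>
     has_iterated_partial_on B
       (concat (map (\<lambda>j. replicate (r j) j) (sorted_list_of_set UNIV))) f g"

text \<open>On nondegenerate boxes, partial derivatives in this sense are unique.\<close>

lemma upd_coord_cbox:
  assumes "u \<in> cbox a b"
  shows "{t. upd_coord u j t \<in> cbox a b} = {a $ j..b $ j}"
  using assms by (auto simp: upd_coord_def mem_box_cart split: if_splits)

lemma has_iterated_partial_on_unique:
  fixes a b :: "real ^ 'd::finite"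
  assumes "\<And>j. a $ j < b $ j"
    and "has_iterated_partial_on (cbox a b) js f g"
    and "has_iterated_partial_on (cbox a b) js f g'"
    and "u \<in> cbox a b"
  shows "g u = g' u"
  using assms(2-4)
proof (induction js arbitrary: g g' u)
  case Nil
  then show ?case by simp
next
  case (Cons j js)
  then obtain h h' where h: "has_iterated_partial_on (cbox a b) js f h" "has_partial_on (cbox a b) j h g"
    and h': "has_iterated_partial_on (cbox a b) js f h'" "has_partial_on (cbox a b) j h' g'"
    by auto
  have uj: "u $ j \<in> {a $ j..b $ j}"
    using Cons.prems by (simp add: mem_box_cart)
  have eq: "h (upd_coord u j t) = h' (upd_coord u j t)" if "t \<in> {a $ j..b $ j}" for t
    using Cons.IH[OF h(1) h'(1)] that upd_coord_cbox[OF Cons.prems(3), of j] by blast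
  have d: "((\<lambda>t. h (upd_coord u j t)) has_vector_derivative g u) (at (u $ j) within {a $ j..b $ j})"
    and d': "((\<lambda>t. h' (upd_coord u j t)) has_vector_derivative g' u) (at (u $ j) within {a $ j..b $ j})"
    using h(2) h'(2) Cons.prems(3)
    unfolding has_partial_on_def by (metis upd_coord_cbox)+
  have "((\<lambda>t. h (upd_coord u j t)) has_vector_derivative g' u) (at (u $ j) within {a $ j..b $ j})"
    by (rule has_vector_derivative_transform[OF uj _ d']) (simp add: eq)
  then show ?case
    using vector_derivative_unique_within_closed_interval[of "a $ j" "b $ j" "u $ j"] d uj assms(1)
    by (metis box_real(2))
qed

section \<open>The surfaces and their control points\<close>

text \<open>
  In the families below the indices are, in this order, \<open>l\<close> (coordinate of the surface), \<open>z\<close>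
  (number of the summand, from \<open>1\<close> to \<open>m l\<close>), \<open>j\<close> (variable) and, for the last four families, the
  frequency.
\<close>

definition trig_surface ::
  "('m::finite \<Rightarrow> nat) \<Rightarrow> ('m \<Rightarrow> nat \<Rightarrow> 'd::finite \<Rightarrow> nat set) \<Rightarrow> ('m \<Rightarrow> nat \<Rightarrow> 'd \<Rightarrow> nat set)
    \<Rightarrow> ('m \<Rightarrow> nat \<Rightarrow> 'd \<Rightarrow> nat \<Rightarrow> real) \<Rightarrow> ('m \<Rightarrow> nat \<Rightarrow> 'd \<Rightarrow> nat \<Rightarrow> real)
    \<Rightarrow> ('m \<Rightarrow> nat \<Rightarrow> 'd \<Rightarrow> nat \<Rightarrow> real) \<Rightarrow> ('m \<Rightarrow> nat \<Rightarrow> 'd \<Rightarrow> nat \<Rightarrow> real)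
    \<Rightarrow> real ^ 'd \<Rightarrow> real ^ 'm"
  where
  "trig_surface m P Q c \<psi> s \<phi> u =
     (\<chi> l. \<Sum>z = 1..m l. \<Prod>j\<in>UNIV.
        (\<Sum>p\<in>P l z j. c l z j p * cos (real p * u $ j + \<psi> l z j p)) +
        (\<Sum>q\<in>Q l z j. s l z j q * sin (real q * u $ j + \<phi> l z j q)))"

text \<open>
  The inserted \<open>0\<close> only matters if there is no frequency at all in the \<open>j\<close>-th variable: the
  maximum of the empty set is read as \<open>0\<close>.
\<close>

definition n_min ::
  "('m \<Rightarrow> nat) \<Rightarrow> ('m \<Rightarrow> nat \<Rightarrow> 'd \<Rightarrow> nat set) \<Rightarrow> ('m \<Rightarrow> nat \<Rightarrow> 'd \<Rightarrow> nat set) \<Rightarrow> 'd \<Rightarrow> nat"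
  where
  "n_min m P Q j = Max (insert 0 (\<Union>l. \<Union>z\<in>{1..m l}. P l z j \<union> Q l z j))"

definition control_factor ::
  "real \<Rightarrow> nat \<Rightarrow> nat set \<Rightarrow> nat set
    \<Rightarrow> (nat \<Rightarrow> real) \<Rightarrow> (nat \<Rightarrow> real) \<Rightarrow> (nat \<Rightarrow> real) \<Rightarrow> (nat \<Rightarrow> real) \<Rightarrow> nat \<Rightarrow> nat \<Rightarrow> real"
  where
  "control_factor \<alpha> n P Q c \<psi> s \<phi> r i =
     (\<Sum>p\<in>P. c p * real p ^ r *
        (mu_coeff \<alpha> n p i * cos (\<psi> p + real r * pi / 2)
         - lambda_coeff \<alpha> n p i * sin (\<psi> p + real r * pi / 2))) +
     (\<Sum>q\<in>Q. s q * real q ^ r *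
        (lambda_coeff \<alpha> n q i * cos (\<phi> q + real r * pi / 2)
         + mu_coeff \<alpha> n q i * sin (\<phi> q + real r * pi / 2)))"

definition control_point ::
  "real ^ 'd \<Rightarrow> ('d \<Rightarrow> nat)
    \<Rightarrow> ('m::finite \<Rightarrow> nat) \<Rightarrow> ('m \<Rightarrow> nat \<Rightarrow> 'd::finite \<Rightarrow> nat set) \<Rightarrow> ('m \<Rightarrow> nat \<Rightarrow> 'd \<Rightarrow> nat set)
    \<Rightarrow> ('m \<Rightarrow> nat \<Rightarrow> 'd \<Rightarrow> nat \<Rightarrow> real) \<Rightarrow> ('m \<Rightarrow> nat \<Rightarrow> 'd \<Rightarrow> nat \<Rightarrow> real)
    \<Rightarrow> ('m \<Rightarrow> nat \<Rightarrow> 'd \<Rightarrow> nat \<Rightarrow> real) \<Rightarrow> ('m \<Rightarrow> nat \<Rightarrow> 'd \<Rightarrow> nat \<Rightarrow> real)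
    \<Rightarrow> ('d \<Rightarrow> nat) \<Rightarrow> ('d \<Rightarrow> nat) \<Rightarrow> real ^ 'm"
  where
  "control_point \<alpha> n m P Q c \<psi> s \<phi> r i =
     (\<chi> l. \<Sum>z = 1..m l. \<Prod>j\<in>UNIV.
        control_factor (\<alpha> $ j) (n j) (P l z j) (Q l z j)
          (c l z j) (\<psi> l z j) (s l z j) (\<phi> l z j) (r j) (i j))"

end

theory Submission
  imports Defs
begin

text \<open>
  Each one-dimensional factor of the surface is a finite sum of terms
  \<open>c cos (p u + \<psi>)\<close> and \<open>s sin (q u + \<phi>)\<close>. Differentiating such a sum multiplies each term by
  its frequency and advances its phase by a quarter turn (\<open>trig_sum_deriv\<close>), so the mixed partial
  derivatives of the surface are again sums of products of such factors
  (\<open>has_iterated_partial_on_surface_deriv\<close>). By the addition theorems, each factor is a linear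
  combination of the functions \<open>cos (k u)\<close> and \<open>sin (k u)\<close> with \<open>k \<le> n\<^sub>j\<close>; replacing these by their
  expansions in the B-basis produces exactly the coefficients of the theorem
  (\<open>trig_sum_eq_tB_sum\<close>), and multiplying out the product over the variables turns it into a
  sum over multi-indices.

  It remains to see that the expansions exist and are unique, which is what gives meaning to
  the definite description in \<open>tB_coords\<close>. Put \<open>x = sin (u / 2)\<close> and
  \<open>y = sin ((\<alpha> - u) / 2)\<close>. Up to the positive constants \<open>tB_coeff\<close>, the basis functions of order
  \<open>n\<close> are the monomials of degree \<open>2 n\<close> in \<open>x\<close> and \<open>y\<close>. Since \<open>cos (u / 2)\<close> is a linear
  combination of \<open>x\<close> and \<open>y\<close>, the addition theorems show that \<open>cos (N u / 2)\<close> and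
  \<open>sin (N u / 2)\<close> are binary forms of degree \<open>N\<close> in \<open>x\<close> and \<open>y\<close>, and multiplication by
  \<open>cos\<^sup>2 (u / 2) + sin\<^sup>2 (u / 2) = 1\<close> raises the degree of a form by two; this gives existence.
  For uniqueness, a binary form of degree \<open>N\<close> vanishing on \<open>[0, \<alpha>]\<close> becomes, after division
  by \<open>y ^ N\<close>, a polynomial in \<open>x / y\<close>; this quotient is injective on \<open>[0, \<alpha>)\<close>, so the polynomial
  has infinitely many roots.
\<close>

section \<open>Binary forms in the two half-angle sines\<close>

text \<open>
  The function \<open>f\<close> is a binary form of degree \<open>N\<close> in \<open>sin ((\<alpha> - u) / 2)\<close> and \<open>sin (u / 2)\<close>.
  The identity is required for all real \<open>u\<close>, not just on \<open>[0, \<alpha>]\<close>.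
\<close>

definition half_angle_form :: "real \<Rightarrow> nat \<Rightarrow> (real \<Rightarrow> real) \<Rightarrow> bool" where
  "half_angle_form \<alpha> N f \<longleftrightarrow>
     (\<exists>b. \<forall>u. f u = (\<Sum>i\<le>N. b i * sin ((\<alpha> - u) / 2) ^ (N - i) * sin (u / 2) ^ i))"

lemma half_angle_form_0: "half_angle_form \<alpha> 0 (\<lambda>u. a)"
  unfolding half_angle_form_def by (rule exI[of _ "\<lambda>i. a"]) simp

lemma half_angle_form_add:
  assumes "half_angle_form \<alpha> N f" "half_angle_form \<alpha> N g"
  shows "half_angle_form \<alpha> N (\<lambda>u. f u + g u)"
proof -
  obtain a b where "\<And>u. f u = (\<Sum>i\<le>N. a i * sin ((\<alpha> - u) / 2) ^ (N - i) * sin (u / 2) ^ i)"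
    "\<And>u. g u = (\<Sum>i\<le>N. b i * sin ((\<alpha> - u) / 2) ^ (N - i) * sin (u / 2) ^ i)"
    using assms unfolding half_angle_form_def by blast
  then show ?thesis
    unfolding half_angle_form_def
    by (intro exI[of _ "\<lambda>i. a i + b i"]) (simp add: sum.distrib algebra_simps)
qed

lemma half_angle_form_scale:
  assumes "half_angle_form \<alpha> N f"
  shows "half_angle_form \<alpha> N (\<lambda>u. a * f u)"
proof -
  obtain b where "\<And>u. f u = (\<Sum>i\<le>N. b i * sin ((\<alpha> - u) / 2) ^ (N - i) * sin (u / 2) ^ i)"
    using assms unfolding half_angle_form_def by blast
  then show ?thesis
    unfolding half_angle_form_def
    by (intro exI[of _ "\<lambda>i. a * b i"]) (simp add: sum_distrib_left algebra_simps)
qed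

lemma half_angle_form_mult_sin:
  assumes "half_angle_form \<alpha> N f"
  shows "half_angle_form \<alpha> (Suc N) (\<lambda>u. sin (u / 2) * f u)"
proof -
  obtain b where b: "\<And>u. f u = (\<Sum>i\<le>N. b i * sin ((\<alpha> - u) / 2) ^ (N - i) * sin (u / 2) ^ i)"
    using assms unfolding half_angle_form_def by blast
  show ?thesis
    unfolding half_angle_form_def
    by (intro exI[of _ "\<lambda>i. if i = 0 then 0 else b (i - 1)"])
      (simp add: b sum.atMost_Suc_shift sum_distrib_left algebra_simps del: sum.atMost_Suc)
qed

lemma half_angle_form_mult_sin_diff:
  assumes "half_angle_form \<alpha> N f"
  shows "half_angle_form \<alpha> (Suc N) (\<lambda>u. sin ((\<alpha> - u) / 2) * f u)"
proof -
  obtain b where b: "\<And>u. f u = (\<Sum>i\<le>N. b i * sin ((\<alpha> - u) / 2) ^ (N - i) * sin (u / 2) ^ i)"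
    using assms unfolding half_angle_form_def by blast
  show ?thesis
    unfolding half_angle_form_def
    by (intro exI[of _ "\<lambda>i. if i \<le> N then b i else 0"])
      (auto simp: b sum_distrib_left Suc_diff_le intro!: sum.cong)
qed

lemma cos_half_eq:
  fixes \<alpha> u :: real
  assumes "sin (\<alpha> / 2) \<noteq> 0"
  shows "cos (u / 2) = 1 / sin (\<alpha> / 2) * sin ((\<alpha> - u) / 2)
    + cos (\<alpha> / 2) / sin (\<alpha> / 2) * sin (u / 2)"
proof -
  have "sin ((\<alpha> - u) / 2) = sin (\<alpha> / 2) * cos (u / 2) - cos (\<alpha> / 2) * sin (u / 2)"
    by (simp only: diff_divide_distrib sin_diff)
  with assms show ?thesis
    by (simp add: right_diff_distrib)
qed

lemma half_angle_form_mult_cos: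
  assumes "sin (\<alpha> / 2) \<noteq> 0" "half_angle_form \<alpha> N f"
  shows "half_angle_form \<alpha> (Suc N) (\<lambda>u. cos (u / 2) * f u)"
proof -
  have "half_angle_form \<alpha> (Suc N) (\<lambda>u. 1 / sin (\<alpha> / 2) * (sin ((\<alpha> - u) / 2) * f u)
      + cos (\<alpha> / 2) / sin (\<alpha> / 2) * (sin (u / 2) * f u))"
    by (intro half_angle_form_add half_angle_form_scale half_angle_form_mult_sin
        half_angle_form_mult_sin_diff assms)
  moreover have "cos (u / 2) * f u = 1 / sin (\<alpha> / 2) * (sin ((\<alpha> - u) / 2) * f u)
      + cos (\<alpha> / 2) / sin (\<alpha> / 2) * (sin (u / 2) * f u)" for u
    by (subst cos_half_eq[OF assms(1)]) (simp only: distrib_right mult.assoc)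
  ultimately show ?thesis by presburger
qed

lemma half_angle_form_cos_sin_half:
  assumes "sin (\<alpha> / 2) \<noteq> 0"
  shows "half_angle_form \<alpha> N (\<lambda>u. cos (real N * u / 2)) \<and>
    half_angle_form \<alpha> N (\<lambda>u. sin (real N * u / 2))"
proof (induction N)
  case 0
  show ?case using half_angle_form_0[of \<alpha> 1] half_angle_form_0[of \<alpha> 0] by simp
next
  case (Suc N)
  have *: "real (Suc N) * u / 2 = u / 2 + real N * u / 2" for u
    by (simp add: field_simps)
  have "half_angle_form \<alpha> (Suc N) (\<lambda>u. cos (u / 2) * cos (real N * u / 2)
      + - 1 * (sin (u / 2) * sin (real N * u / 2)))"
    "half_angle_form \<alpha> (Suc N) (\<lambda>u. sin (u / 2) * cos (real N * u / 2)
      + cos (u / 2) * sin (real N * u / 2))"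
    by (intro half_angle_form_add half_angle_form_scale half_angle_form_mult_sin
        half_angle_form_mult_cos assms Suc.IH[THEN conjunct1] Suc.IH[THEN conjunct2])+
  then show ?case
    unfolding * cos_add sin_add by simp
qed

lemma half_angle_form_raise_degree:
  assumes "sin (\<alpha> / 2) \<noteq> 0" "half_angle_form \<alpha> N f"
  shows "half_angle_form \<alpha> (N + 2 * k) f"
proof (induction k)
  case 0
  show ?case using assms by simp
next
  case (Suc k)
  have "half_angle_form \<alpha> (Suc (Suc (N + 2 * k)))
      (\<lambda>u. cos (u / 2) * (cos (u / 2) * f u) + sin (u / 2) * (sin (u / 2) * f u))"
    by (intro half_angle_form_add half_angle_form_mult_sin half_angle_form_mult_cos assms(1) Suc.IH)
  moreover have "cos (u / 2) * (cos (u / 2) * f u) + sin (u / 2) * (sin (u / 2) * f u) = f u" for u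
    by (metis cos_squared_eq diff_add_cancel distrib_right mult.assoc mult_1 power2_eq_square)
  ultimately show ?case by simp
qed

lemma half_angle_form_cos_sin:
  assumes "sin (\<alpha> / 2) \<noteq> 0" "k \<le> n"
  shows "half_angle_form \<alpha> (2 * n) (\<lambda>u. cos (real k * u))"
    and "half_angle_form \<alpha> (2 * n) (\<lambda>u. sin (real k * u))"
proof -
  have deg: "2 * k + 2 * (n - k) = 2 * n" and arg: "real (2 * k) * u / 2 = real k * u" for u
    using assms(2) by simp_all
  have "half_angle_form \<alpha> (2 * k) (\<lambda>u. cos (real k * u))"
    "half_angle_form \<alpha> (2 * k) (\<lambda>u. sin (real k * u))"
    using half_angle_form_cos_sin_half[OF assms(1), of "2 * k", unfolded arg] by blast+
  from this[THEN half_angle_form_raise_degree[OF assms(1), where k = "n - k"]]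
  show "half_angle_form \<alpha> (2 * n) (\<lambda>u. cos (real k * u))"
    "half_angle_form \<alpha> (2 * n) (\<lambda>u. sin (real k * u))"
    unfolding deg by blast+
qed

text \<open>
  For \<open>u, v\<close> in \<open>[0, \<alpha>)\<close>, the difference of the two quotients has numerator
  \<open>sin (\<alpha> / 2) sin ((u - v) / 2)\<close>, which vanishes only for \<open>u = v\<close>.
\<close>

lemma inj_on_half_angle_quotient:
  assumes "\<alpha> \<in> {0<..<pi}"
  shows "inj_on (\<lambda>u. sin (u / 2) / sin ((\<alpha> - u) / 2)) {0..<\<alpha>}"
proof (rule inj_onI)
  fix u v
  assume uv: "u \<in> {0..<\<alpha>}" "v \<in> {0..<\<alpha>}"
    and eq: "sin (u / 2) / sin ((\<alpha> - u) / 2) = sin (v / 2) / sin ((\<alpha> - v) / 2)"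
  have "sin ((\<alpha> - u) / 2) > 0" "sin ((\<alpha> - v) / 2) > 0" and S: "sin (\<alpha> / 2) > 0"
    using uv assms by (auto intro!: sin_gt_zero)
  with eq have cross: "sin (u / 2) * sin ((\<alpha> - v) / 2) = sin (v / 2) * sin ((\<alpha> - u) / 2)"
    by (simp add: field_simps)
  have "sin (\<alpha> / 2) * sin ((u - v) / 2) = 0"
    using cross by (simp add: diff_divide_distrib sin_diff algebra_simps)
  with S have "sin ((u - v) / 2) = 0" by simp
  moreover have "- pi < (u - v) / 2" "(u - v) / 2 < pi"
    using uv assms by auto
  ultimately have "(u - v) / 2 = 0"
    using sin_eq_0_pi[of "(u - v) / 2"] by blast
  then show "u = v" by simp
qed

lemma half_angle_monomials_independent:
  assumes "\<alpha> \<in> {0<..<pi}"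
    and zero: "\<And>u. u \<in> {0..\<alpha>} \<Longrightarrow>
      (\<Sum>i\<le>N. b i * sin ((\<alpha> - u) / 2) ^ (N - i) * sin (u / 2) ^ i) = 0"
    and "i \<le> N"
  shows "b i = 0"
proof (rule ccontr)
  assume "b i \<noteq> 0"
  let ?q = "\<lambda>u. sin (u / 2) / sin ((\<alpha> - u) / 2)"
  have "(\<Sum>i\<le>N. b i * ?q u ^ i) = 0" if u: "u \<in> {0..<\<alpha>}" for u
  proof -
    have y: "sin ((\<alpha> - u) / 2) > 0"
      using u assms(1) by (auto intro!: sin_gt_zero)
    have monomial: "b i * sin ((\<alpha> - u) / 2) ^ (N - i) * sin (u / 2) ^ i
        = sin ((\<alpha> - u) / 2) ^ N * (b i * ?q u ^ i)" if "i \<le> N" for i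
      using y that by (simp add: power_divide power_diff field_simps)
    have "sin ((\<alpha> - u) / 2) ^ N * (\<Sum>i\<le>N. b i * ?q u ^ i)
        = (\<Sum>i\<le>N. b i * sin ((\<alpha> - u) / 2) ^ (N - i) * sin (u / 2) ^ i)"
      unfolding sum_distrib_left by (intro sum.cong refl monomial[symmetric]) simp
    also have "\<dots> = 0"
      using zero[of u] u by simp
    finally have "sin ((\<alpha> - u) / 2) ^ N * (\<Sum>i\<le>N. b i * ?q u ^ i) = 0" .
    with y show ?thesis by simp
  qed
  then have "?q ` {0..<\<alpha>} \<subseteq> {z. (\<Sum>i\<le>N. b i * z ^ i) = 0}" by auto
  moreover have "finite {z. (\<Sum>i\<le>N. b i * z ^ i) = 0}"
    using \<open>b i \<noteq> 0\<close> assms(3) by (subst polyfun_finite_roots) blast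
  ultimately have "finite (?q ` {0..<\<alpha>})" by (rule finite_subset)
  then have "finite {0..<\<alpha>}"
    using inj_on_half_angle_quotient[OF assms(1)] by (rule finite_imageD)
  then show False
    using assms(1) by (simp add: infinite_Ico)
qed

section \<open>Expansions in the normalized B-basis\<close>

lemma tB_coeff_pos:
  assumes "\<alpha> \<in> {0<..<pi}" "i \<le> 2 * n"
  shows "tB_coeff \<alpha> n i > 0"
proof -
  have S: "sin (\<alpha> / 2) > 0" and C: "cos (\<alpha> / 2) > 0"
    using assms by (auto intro!: sin_gt_zero cos_gt_zero_pi)
  have "(\<Sum>r = 0..i div 2. real (n choose (i - r)) * real ((i - r) choose r)
      * (2 * cos (\<alpha> / 2)) ^ (i - 2 * r)) > 0"
  proof (rule sum_pos2)
    \<comment> \<open>The last summand is positive: for \<open>r = i div 2\<close> both \<open>i - r \<le> n\<close> and \<open>r \<le> i - r\<close> hold.\<close>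
    show "i div 2 \<in> {0..i div 2}" by simp
    have "i - i div 2 \<le> n" "i div 2 \<le> i - i div 2"
      using assms(2) by linarith+
    then show "0 < real (n choose (i - i div 2)) * real ((i - i div 2) choose (i div 2))
        * (2 * cos (\<alpha> / 2)) ^ (i - 2 * (i div 2))"
      using C by (intro mult_pos_pos) (simp_all add: zero_less_binomial)
  qed (use C in auto)
  with S show ?thesis
    unfolding tB_coeff_def by simp
qed

text \<open>
  A binary form of degree \<open>2n\<close> has exactly one expansion in the basis, and \<open>tB_coords\<close>
  picks it out.
\<close>

lemma tB_coords_expansion:
  assumes \<alpha>: "\<alpha> \<in> {0<..<pi}" and f: "half_angle_form \<alpha> (2 * n) f" and u: "u \<in> {0..\<alpha>}"
  shows "f u = (\<Sum>i = 0..2 * n. tB_coords \<alpha> n f i * tB \<alpha> n i u)"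
proof -
  let ?C = "\<lambda>a. (\<forall>i > 2 * n. a i = 0) \<and> (\<forall>u \<in> {0..\<alpha>}. f u = (\<Sum>i = 0..2 * n. a i * tB \<alpha> n i u))"
  obtain b where b: "\<And>u. f u = (\<Sum>i\<le>2*n. b i * sin ((\<alpha> - u) / 2) ^ (2*n - i) * sin (u / 2) ^ i)"
    using f unfolding half_angle_form_def by blast
  have "\<exists>!a. ?C a"
  proof (rule ex_ex1I)
    have "b i * sin ((\<alpha> - u) / 2) ^ (2*n - i) * sin (u / 2) ^ i
        = (if i \<le> 2 * n then b i / tB_coeff \<alpha> n i else 0) * tB \<alpha> n i u" if "i \<le> 2 * n" for i u
      using that tB_coeff_pos[OF \<alpha> that] by (simp add: tB_def)
    then show "\<exists>a. ?C a"
      by (intro exI[of _ "\<lambda>i. if i \<le> 2 * n then b i / tB_coeff \<alpha> n i else 0"])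
        (auto simp: b atLeast0AtMost intro!: sum.cong)
  next
    fix a a'
    assume a: "?C a" and a': "?C a'"
    have "(a i - a' i) * tB_coeff \<alpha> n i = 0" if "i \<le> 2 * n" for i
    proof (rule half_angle_monomials_independent[OF \<alpha> _ that])
      fix u assume u: "u \<in> {0..\<alpha>}"
      have "(\<Sum>i = 0..2 * n. a i * tB \<alpha> n i u) - (\<Sum>i = 0..2 * n. a' i * tB \<alpha> n i u) = 0"
        using a a' u by auto
      then show "(\<Sum>i\<le>2 * n. (a i - a' i) * tB_coeff \<alpha> n i
          * sin ((\<alpha> - u) / 2) ^ (2 * n - i) * sin (u / 2) ^ i) = 0"
        by (simp add: tB_def atLeast0AtMost sum_subtractf[symmetric] algebra_simps)
    qed
    then have "a i = a' i" if "i \<le> 2 * n" for i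
      using that tB_coeff_pos[OF \<alpha> that] by fastforce
    then show "a = a'"
      using a a' by (intro ext) (metis not_le)
  qed
  then have "?C (tB_coords \<alpha> n f)"
    unfolding tB_coords_def by (rule theI')
  with u show ?thesis by blast
qed

lemma cos_sin_eq_tB_sum:
  assumes "\<alpha> \<in> {0<..<pi}" "k \<le> n" "u \<in> {0..\<alpha>}"
  shows "cos (real k * u) = (\<Sum>i = 0..2 * n. mu_coeff \<alpha> n k i * tB \<alpha> n i u)"
    and "sin (real k * u) = (\<Sum>i = 0..2 * n. lambda_coeff \<alpha> n k i * tB \<alpha> n i u)"
proof -
  have "sin (\<alpha> / 2) > 0"
    using assms(1) by (intro sin_gt_zero) auto
  then show "cos (real k * u) = (\<Sum>i = 0..2 * n. mu_coeff \<alpha> n k i * tB \<alpha> n i u)"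
    "sin (real k * u) = (\<Sum>i = 0..2 * n. lambda_coeff \<alpha> n k i * tB \<alpha> n i u)"
    unfolding mu_coeff_def lambda_coeff_def
    by (intro tB_coords_expansion half_angle_form_cos_sin assms; simp)+
qed

section \<open>Derivatives of trigonometric sums\<close>

text \<open>
  The \<open>r\<close>-th derivative of \<open>\<Sum>p\<in>P. c p * cos (p x + \<psi> p) + \<Sum>q\<in>Q. s q * sin (q x + \<phi> q)\<close>, in
  closed form; \<open>trig_sum_deriv\<close> justifies the description.
\<close>

definition trig_sum :: "nat set \<Rightarrow> nat set \<Rightarrow> (nat \<Rightarrow> real) \<Rightarrow> (nat \<Rightarrow> real) \<Rightarrow> (nat \<Rightarrow> real)
    \<Rightarrow> (nat \<Rightarrow> real) \<Rightarrow> nat \<Rightarrow> real \<Rightarrow> real" where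
  "trig_sum P Q c \<psi> s \<phi> r x =
     (\<Sum>p\<in>P. c p * real p ^ r * cos (real p * x + (\<psi> p + real r * pi / 2))) +
     (\<Sum>q\<in>Q. s q * real q ^ r * sin (real q * x + (\<phi> q + real r * pi / 2)))"

lemma trig_sum_deriv:
  "(trig_sum P Q c \<psi> s \<phi> r has_real_derivative trig_sum P Q c \<psi> s \<phi> (Suc r) x) (at x)"
proof -
  have shift: "y + (z + real (Suc r) * pi / 2) = (y + (z + real r * pi / 2)) + pi / 2" for y z
    by (simp add: field_simps)
  have quarter: "cos (y + pi / 2) = - sin y" "sin (y + pi / 2) = cos y" for y
    by (simp_all add: cos_add sin_add)
  show ?thesis
    unfolding trig_sum_def shift quarter
    by (rule derivative_eq_intros refl)+
      (auto simp: algebra_simps sum_negf intro!: sum.cong)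
qed

lemma trig_sum_eq_tB_sum:
  assumes \<alpha>: "\<alpha> \<in> {0<..<pi}" and x: "x \<in> {0..\<alpha>}" and PQ: "\<And>k. k \<in> P \<union> Q \<Longrightarrow> k \<le> n"
  shows "trig_sum P Q c \<psi> s \<phi> r x
    = (\<Sum>i = 0..2 * n. control_factor \<alpha> n P Q c \<psi> s \<phi> r i * tB \<alpha> n i x)"
proof -
  have *: "a * cos (real k * x + y)
      = (\<Sum>i = 0..2 * n. a * (mu_coeff \<alpha> n k i * cos y - lambda_coeff \<alpha> n k i * sin y) * tB \<alpha> n i x)"
    "a * sin (real k * x + y)
      = (\<Sum>i = 0..2 * n. a * (lambda_coeff \<alpha> n k i * cos y + mu_coeff \<alpha> n k i * sin y) * tB \<alpha> n i x)"
    if "k \<in> P \<union> Q" for a k y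
    unfolding cos_add sin_add cos_sin_eq_tB_sum[OF \<alpha> PQ[OF that] x]
    by (simp_all add: sum_distrib_left sum_distrib_right sum.distrib[symmetric]
        sum_subtractf[symmetric] algebra_simps)
  have "trig_sum P Q c \<psi> s \<phi> r x =
      (\<Sum>p\<in>P. \<Sum>i = 0..2 * n. c p * real p ^ r * (mu_coeff \<alpha> n p i * cos (\<psi> p + real r * pi / 2)
        - lambda_coeff \<alpha> n p i * sin (\<psi> p + real r * pi / 2)) * tB \<alpha> n i x) +
      (\<Sum>q\<in>Q. \<Sum>i = 0..2 * n. s q * real q ^ r * (lambda_coeff \<alpha> n q i * cos (\<phi> q + real r * pi / 2)
        + mu_coeff \<alpha> n q i * sin (\<phi> q + real r * pi / 2)) * tB \<alpha> n i x)"
    unfolding trig_sum_def by (intro arg_cong2[where f = "(+)"] sum.cong refl *) auto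
  also have "\<dots> = (\<Sum>i = 0..2 * n. control_factor \<alpha> n P Q c \<psi> s \<phi> r i * tB \<alpha> n i x)"
    unfolding control_factor_def distrib_right sum.distrib sum_distrib_right
    by (intro arg_cong2[where f = "(+)"] sum.swap)
  finally show ?thesis .
qed

section \<open>Mixed partial derivatives of the surface\<close>

lemma has_vector_derivative_vec_lambda:
  fixes f :: "real \<Rightarrow> 'm::finite \<Rightarrow> real"
  assumes "\<And>l. ((\<lambda>t. f t l) has_real_derivative f' l) F"
  shows "((\<lambda>t. \<chi> l. f t l) has_vector_derivative (\<chi> l. f' l)) F"
proof -
  have eq: "(\<chi> l. g l) = (\<Sum>l\<in>UNIV. g l *\<^sub>R axis l (1::real))" for g :: "'m \<Rightarrow> real"
    by (simp add: vec_eq_iff axis_def if_distrib cong: if_cong)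
  show ?thesis
    unfolding eq using assms
    by (intro has_vector_derivative_sum bounded_linear.has_vector_derivative[OF bounded_linear_scaleR_left])
      (simp add: has_real_derivative_iff_has_vector_derivative)
qed

text \<open>
  The partial derivative of order \<open>r\<close> of the surface, in closed form; for \<open>r = 0\<close> this is the
  surface itself.
\<close>

definition surface_deriv ::
  "('m::finite \<Rightarrow> nat) \<Rightarrow> ('m \<Rightarrow> nat \<Rightarrow> 'd::finite \<Rightarrow> nat set) \<Rightarrow> ('m \<Rightarrow> nat \<Rightarrow> 'd \<Rightarrow> nat set)
    \<Rightarrow> ('m \<Rightarrow> nat \<Rightarrow> 'd \<Rightarrow> nat \<Rightarrow> real) \<Rightarrow> ('m \<Rightarrow> nat \<Rightarrow> 'd \<Rightarrow> nat \<Rightarrow> real)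
    \<Rightarrow> ('m \<Rightarrow> nat \<Rightarrow> 'd \<Rightarrow> nat \<Rightarrow> real) \<Rightarrow> ('m \<Rightarrow> nat \<Rightarrow> 'd \<Rightarrow> nat \<Rightarrow> real)
    \<Rightarrow> ('d \<Rightarrow> nat) \<Rightarrow> real ^ 'd \<Rightarrow> real ^ 'm"
  where
  "surface_deriv m P Q c \<psi> s \<phi> r u =
     (\<chi> l. \<Sum>z = 1..m l. \<Prod>j\<in>UNIV.
        trig_sum (P l z j) (Q l z j) (c l z j) (\<psi> l z j) (s l z j) (\<phi> l z j) (r j) (u $ j))"

lemma surface_deriv_0:
  "surface_deriv m P Q c \<psi> s \<phi> (\<lambda>j. 0) = trig_surface m P Q c \<psi> s \<phi>"
  by (simp add: fun_eq_iff surface_deriv_def trig_surface_def trig_sum_def)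

lemma has_partial_on_surface_deriv:
  fixes j :: "'d::finite"
  shows "has_partial_on B j (surface_deriv m P Q c \<psi> s \<phi> r)
     (surface_deriv m P Q c \<psi> s \<phi> (r(j := Suc (r j))))"
  unfolding has_partial_on_def
proof
  fix u :: "real ^ 'd"
  let ?F = "\<lambda>l z k. trig_sum (P l z k) (Q l z k) (c l z k) (\<psi> l z k) (s l z k) (\<phi> l z k)"
  \<comment> \<open>Only the factor with index \<open>j\<close> depends on the \<open>j\<close>-th variable.\<close>
  have split: "(\<Prod>k\<in>UNIV. ?F l z k (r' k) (upd_coord u j t $ k))
      = ?F l z j (r' j) t * (\<Prod>k\<in>UNIV - {j}. ?F l z k (r k) (u $ k))"
    if "\<And>k. k \<noteq> j \<Longrightarrow> r' k = r k" for l z t r'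
    using that by (subst prod.remove[of _ j]) (auto simp: upd_coord_def intro!: prod.cong)
  have u: "upd_coord u j (u $ j) = u"
    by (simp add: upd_coord_def vec_eq_iff)
  have "((\<lambda>t. \<Prod>k\<in>UNIV. ?F l z k (r k) (upd_coord u j t $ k)) has_real_derivative
      (\<Prod>k\<in>UNIV. ?F l z k ((r(j := Suc (r j))) k) (upd_coord u j (u $ j) $ k))) (at (u $ j))" for l z
    by (subst (1 2) split) (auto intro!: DERIV_cmult_right trig_sum_deriv)
  then have "((\<lambda>t. surface_deriv m P Q c \<psi> s \<phi> r (upd_coord u j t)) has_vector_derivative
      surface_deriv m P Q c \<psi> s \<phi> (r(j := Suc (r j))) u) (at (u $ j))"
    unfolding surface_deriv_def u by (intro has_vector_derivative_vec_lambda DERIV_sum)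
  then show "((\<lambda>t. surface_deriv m P Q c \<psi> s \<phi> r (upd_coord u j t)) has_vector_derivative
      surface_deriv m P Q c \<psi> s \<phi> (r(j := Suc (r j))) u)
      (at (u $ j) within {t. upd_coord u j t \<in> B})"
    by (rule has_vector_derivative_at_within)
qed

lemma has_iterated_partial_on_surface_deriv:
  "has_iterated_partial_on B js (trig_surface m P Q c \<psi> s \<phi>)
     (surface_deriv m P Q c \<psi> s \<phi> (count_list js))"
proof (induction js)
  case Nil
  show ?case by (simp add: surface_deriv_0[symmetric])
next
  case (Cons j js)
  have "count_list (j # js) = (count_list js)(j := Suc (count_list js j))"
    by (auto simp: fun_eq_iff)
  then have "has_partial_on B j (surface_deriv m P Q c \<psi> s \<phi> (count_list js))
      (surface_deriv m P Q c \<psi> s \<phi> (count_list (j # js)))"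
    by (simp only: has_partial_on_surface_deriv)
  with Cons.IH show ?case
    unfolding has_iterated_partial_on.simps by blast
qed

text \<open>
  The resulting function enters the definition only through its values on \<open>B\<close>; unlike the
  intermediate derivatives, it is not differentiated again.
\<close>

lemma has_iterated_partial_on_cong:
  assumes "has_iterated_partial_on B js f g" "\<And>u. u \<in> B \<Longrightarrow> g u = h u"
  shows "has_iterated_partial_on B js f h"
  using assms by (cases js) (auto simp: has_partial_on_def)

lemma count_list_concat_replicate:
  assumes "distinct xs"
  shows "count_list (concat (map (\<lambda>j. replicate (r j) j) xs)) k = (if k \<in> set xs then r k else 0)"
proof -
  have "count_list (replicate a j) k = (if j = k then a else 0)" for a j
    by (induction a) auto
  then show ?thesis
    using assms by (induction xs) auto
qed

section \<open>The control points of the derivatives\<close>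

lemma frequency_le_n_min:
  fixes P Q :: "'m::finite \<Rightarrow> nat \<Rightarrow> 'd \<Rightarrow> nat set"
  assumes "\<And>l z j. z \<in> {1..m l} \<Longrightarrow> finite (P l z j)"
    and "\<And>l z j. z \<in> {1..m l} \<Longrightarrow> finite (Q l z j)"
    and "z \<in> {1..m l}" "k \<in> P l z j \<union> Q l z j"
  shows "k \<le> n_min m P Q j"
proof -
  have "finite (\<Union>l. \<Union>z\<in>{1..m l}. P l z j \<union> Q l z j)"
    using assms(1,2) by (intro finite_UN_I finite_UnI) auto
  then show ?thesis
    unfolding n_min_def using assms(3,4) by (intro Max_ge) auto
qed

lemma surface_deriv_eq_tB_sum:
  assumes \<alpha>: "\<And>j. \<alpha> $ j \<in> {0<..<pi}" and u: "u \<in> cbox 0 \<alpha>"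
    and n: "\<And>l z j k. z \<in> {1..m l} \<Longrightarrow> k \<in> P l z j \<union> Q l z j \<Longrightarrow> k \<le> n j"
  shows "surface_deriv m P Q c \<psi> s \<phi> r u = (\<Sum>i \<in> (\<Pi>\<^sub>E j\<in>UNIV. {0..2 * n j}).
    (\<Prod>j\<in>UNIV. tB (\<alpha> $ j) (n j) (i j) (u $ j)) *\<^sub>R control_point \<alpha> n m P Q c \<psi> s \<phi> r i)"
proof -
  let ?d = "\<lambda>l z j. control_factor (\<alpha> $ j) (n j) (P l z j) (Q l z j)
    (c l z j) (\<psi> l z j) (s l z j) (\<phi> l z j) (r j)"
  let ?T = "\<lambda>j i. tB (\<alpha> $ j) (n j) i (u $ j)"
  have uj: "u $ j \<in> {0..\<alpha> $ j}" for j
    using u by (simp add: mem_box_cart)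
  have "(\<Prod>j\<in>UNIV. trig_sum (P l z j) (Q l z j) (c l z j) (\<psi> l z j) (s l z j) (\<phi> l z j) (r j) (u $ j))
      = (\<Sum>i \<in> (\<Pi>\<^sub>E j\<in>UNIV. {0..2 * n j}). (\<Prod>j\<in>UNIV. ?T j (i j)) * (\<Prod>j\<in>UNIV. ?d l z j (i j)))"
    if "z \<in> {1..m l}" for l z
  proof -
    have "(\<Prod>j\<in>UNIV. trig_sum (P l z j) (Q l z j) (c l z j) (\<psi> l z j) (s l z j) (\<phi> l z j) (r j) (u $ j))
        = (\<Prod>j\<in>UNIV. \<Sum>i\<in>{0..2 * n j}. ?d l z j i * ?T j i)"
      by (intro prod.cong refl trig_sum_eq_tB_sum \<alpha> uj n[OF that])
    also have "\<dots> = (\<Sum>i \<in> (\<Pi>\<^sub>E j\<in>UNIV. {0..2 * n j}). \<Prod>j\<in>UNIV. ?d l z j (i j) * ?T j (i j))"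
      by (rule prod_sum_PiE) auto
    finally show ?thesis by (simp add: prod.distrib mult.commute)
  qed
  then have "surface_deriv m P Q c \<psi> s \<phi> r u $ l = (\<Sum>i \<in> (\<Pi>\<^sub>E j\<in>UNIV. {0..2 * n j}).
      (\<Prod>j\<in>UNIV. ?T j (i j)) * (\<Sum>z = 1..m l. \<Prod>j\<in>UNIV. ?d l z j (i j)))" for l
    unfolding sum_distrib_left by (subst sum.swap) (simp add: surface_deriv_def)
  then show ?thesis
    by (simp add: vec_eq_iff control_point_def)
qed

theorem theorem5p2:
  fixes \<alpha> :: "real ^ 'd::{finite,linorder}"
    and \<kappa> :: nat
    and m :: "'m::finite \<Rightarrow> nat"
    and P Q :: "'m \<Rightarrow> nat \<Rightarrow> 'd \<Rightarrow> nat set"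
    and c \<psi> s \<phi> :: "'m \<Rightarrow> nat \<Rightarrow> 'd \<Rightarrow> nat \<Rightarrow> real"
    and n r :: "'d \<Rightarrow> nat"
  assumes "CARD('d) \<ge> 2"
    and "CARD('m) = CARD('d) + \<kappa>"
    and "\<And>j. \<alpha> $ j \<in> {0<..<pi}"
    and "\<And>l. m l \<ge> 1"
    and "\<And>l z j. z \<in> {1..m l} \<Longrightarrow> finite (P l z j)"
    and "\<And>l z j. z \<in> {1..m l} \<Longrightarrow> finite (Q l z j)"
    and "\<And>j. n j \<ge> 1"
    and "\<And>j. n j \<ge> n_min m P Q j"
  shows "has_mixed_partial_on (cbox 0 \<alpha>) r (trig_surface m P Q c \<psi> s \<phi>)
    (\<lambda>u. \<Sum>i \<in> (\<Pi>\<^sub>E j\<in>UNIV. {0..2 * n j}).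
       (\<Prod>j\<in>UNIV. tB (\<alpha> $ j) (n j) (i j) (u $ j)) *\<^sub>R control_point \<alpha> n m P Q c \<psi> s \<phi> r i)"
proof -
  let ?js = "concat (map (\<lambda>j. replicate (r j) j) (sorted_list_of_set (UNIV :: 'd set)))"
  have count: "count_list ?js = r"
    by (simp add: fun_eq_iff count_list_concat_replicate)
  have freq: "k \<le> n j" if "z \<in> {1..m l}" "k \<in> P l z j \<union> Q l z j" for l z j k
  proof -
    have "k \<le> n_min m P Q j"
    proof (rule frequency_le_n_min)
      show "finite (P l z j)" "finite (Q l z j)" if "z \<in> {1..m l}" for l z j
        using assms(5,6) that by blast+
    qed (fact that)+
    with assms(8)[of j] show ?thesis by linarith
  qed
  show ?thesis
    unfolding has_mixed_partial_on_def
  proof (rule has_iterated_partial_on_cong)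
    show "has_iterated_partial_on (cbox 0 \<alpha>) ?js (trig_surface m P Q c \<psi> s \<phi>)
        (surface_deriv m P Q c \<psi> s \<phi> r)"
      using has_iterated_partial_on_surface_deriv[of "cbox 0 \<alpha>" ?js m P Q c \<psi> s \<phi>]
      by (simp only: count)
  qed (rule surface_deriv_eq_tB_sum[OF assms(3) _ freq])
qed

end
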